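(* For all integers $m>1$ and $1\le i\le m$, the function $x\mapsto r_{i,m}(x)$ is continuous on the interval $[1,\infty)$.
   Context: For an integer $n\ge 1$ and an integer $k$, let $\left(\!\binom{n}{k}\!\right)=\binom{n+k-1}{k}$ if $k\ge 0$ (so it is $1$ for $k=0$), and $\left(\!\binom{n}{k}\!\right)=0$ if $k<0$. For integers $m\ge 1$, $a\ge 1$, let $\Lambda_m(a)$ be the $(m+1)\times(m+1)$ matrix whose $(p,q)$ entry is $\left(\!\binom{a}{m+2-p-q}\!\right)$, $1\le p,q\le m+1$. Write $[a_1,a_2,\dots]$ for the simple continued fraction $a_1+\cfrac{1}{a_2+\cdots}$; for real $x\ge 1$ all $a_j$ are positive integers and $a_1=\lfloor x\rfloor$. For rational $x=[a_1,\dots,a_n]\ge 1$, let $M=\Lambda_m(a_1)\cdots\Lambda_m(a_n)$; the numbers $r_{i,m}(x)$, $0\le i\le m$, are defined by $$(r_{m,m}(x),r_{m-1,m}(x),\dots,r_{1,m}(x),r_{0,m}(x))^\top=\frac{1}{M_{m+1,1}}\,(\text{first column of }M),$$ so $r_{0,m}(x)=1$ (the two finite continued fraction expansions of a rational number give the same values). For irrational $x=[a_1,a_2,\dots]>1$ with convergents $x_n=[a_1,\dots,a_n]$, define $r_{i,m}(x)=\lim_{n\to\infty}r_{i,m}(x_n)$; this limit is known to exist. *)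

theory Defs
  imports Complex_Main "Jordan_Normal_Form.Matrix"
begin

definition multichoose :: "nat \<Rightarrow> int \<Rightarrow> nat" where
  "multichoose n k = (if k \<ge> 0 then (n + nat k - 1) choose nat k else 0)"

(* Matrix indices start at 0 here, so the exponent m + 2 - p - q of the
   usual 1-based convention becomes m - p - q; it may be negative. *)
definition Lambda_mat :: "nat \<Rightarrow> nat \<Rightarrow> real mat" where
  "Lambda_mat m a =
     mat (m + 1) (m + 1) (\<lambda>(p, q). real (multichoose a (int m - int p - int q)))"

definition Lambda_prod :: "nat \<Rightarrow> nat list \<Rightarrow> real mat" where
  "Lambda_prod m as = foldr (\<lambda>a M. Lambda_mat m a * M) as (1\<^sub>m (m + 1))"

definition r_vec :: "nat \<Rightarrow> nat list \<Rightarrow> real vec" where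
  "r_vec m as = (1 / Lambda_prod m as $$ (m, 0)) \<cdot>\<^sub>v col (Lambda_prod m as) 0"

(* Only nonempty lists are continued fractions; the first equation is a dummy. *)
fun cf_value :: "nat list \<Rightarrow> real" where
  "cf_value [] = 0"
| "cf_value [a] = real a"
| "cf_value (a # b # as) = real a + 1 / cf_value (b # as)"

definition cf_expansion :: "real \<Rightarrow> nat list \<Rightarrow> bool" where
  "cf_expansion x as \<longleftrightarrow> as \<noteq> [] \<and> (\<forall>a\<in>set as. a \<ge> 1) \<and> cf_value as = x"

(* The coordinates of r_vec are listed from i = m down to i = 0. The two
   expansions of a rational number give the same r_vec, see r_rat_eq. *)
definition r_rat :: "nat \<Rightarrow> nat \<Rightarrow> real \<Rightarrow> real" where
  "r_rat i m x = r_vec m (SOME as. cf_expansion x as) $ (m - i)"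

primrec complete_quotient :: "real \<Rightarrow> nat \<Rightarrow> real" where
  "complete_quotient x 0 = x"
| "complete_quotient x (Suc n) = 1 / frac (complete_quotient x n)"

definition partial_quotient :: "real \<Rightarrow> nat \<Rightarrow> nat" where
  "partial_quotient x n = nat \<lfloor>complete_quotient x n\<rfloor>"

definition convergent_cf :: "real \<Rightarrow> nat \<Rightarrow> real" where
  "convergent_cf x n = cf_value (map (partial_quotient x) [0..<Suc n])"

(* Meaningful for x \<ge> 1. *)
definition r :: "nat \<Rightarrow> nat \<Rightarrow> real \<Rightarrow> real" where
  "r i m x = (if x \<in> \<rat> then r_rat i m x else lim (\<lambda>n. r_rat i m (convergent_cf x n)))"

lemma cf_value_Cons: "as \<noteq> [] \<Longrightarrow> cf_value (a # as) = real a + 1 / cf_value as"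
  by (cases as) auto

lemma cf_value_ge_1: "as \<noteq> [] \<Longrightarrow> \<forall>a\<in>set as. a \<ge> 1 \<Longrightarrow> cf_value as \<ge> 1"
  by (induction as rule: cf_value.induct) (auto intro: add_increasing2)

lemma cf_value_eq_1:
  assumes "as \<noteq> []" "\<forall>a\<in>set as. a \<ge> 1" "cf_value as = 1"
  shows "as = [1]"
proof (cases as rule: cf_value.cases)
  case (3 a b bs)
  then have "cf_value (b # bs) \<ge> 1"
    using assms by (intro cf_value_ge_1) auto
  then have "1 / cf_value (b # bs) > 0" by simp
  moreover have "real a \<ge> 1" using assms 3 by auto
  moreover have "real a + 1 / cf_value (b # bs) = 1" using assms 3 by simp
  ultimately show ?thesis by linarith
qed (use assms in auto)

lemma cf_expansion_exists:
  assumes "x \<in> \<rat>" "x \<ge> 1"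
  shows "\<exists>as. cf_expansion x as"
proof -
  have *: "\<exists>as. cf_expansion (real p / real q) as" if "0 < q" "q \<le> p" for p q :: nat
    using that
  proof (induction q arbitrary: p rule: less_induct)
    case (less q)
    have split: "real p / real q = real (p div q) + real (p mod q) / real q"
      using less.prems by (simp add: real_of_nat_div field_simps flip: of_nat_mult of_nat_add)
    have ge: "p div q \<ge> 1"
      using less.prems by (simp add: Suc_le_eq div_greater_zero_iff)
    show ?case
    proof (cases "p mod q = 0")
      case True
      then have "cf_expansion (real p / real q) [p div q]"
        using split ge by (simp add: cf_expansion_def)
      then show ?thesis ..
    next
      case False
      then obtain as where as: "cf_expansion (real q / real (p mod q)) as"
        using less.IH[of "p mod q" q] less.prems by (auto intro: less_imp_le)
      then have "cf_expansion (real p / real q) ((p div q) # as)"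
        using split ge by (auto simp: cf_expansion_def cf_value_Cons)
      then show ?thesis ..
    qed
  qed
  obtain p q where pq: "q \<noteq> 0" "\<bar>x\<bar> = real p / real q"
    using Rats_abs_nat_div_natE[OF assms(1)] by metis
  then have "real p / real q \<ge> 1" using assms(2) by simp
  then have "q \<le> p" using pq by (simp add: le_divide_eq split: if_splits)
  then show ?thesis using *[of q p] pq assms(2) by simp
qed

lemma Lambda_mat_carrier [simp]: "Lambda_mat m a \<in> carrier_mat (m + 1) (m + 1)"
  by (simp add: Lambda_mat_def)

lemma Lambda_prod_carrier [simp]: "Lambda_prod m as \<in> carrier_mat (m + 1) (m + 1)"
proof (induction as)
  case (Cons a as)
  then show ?case
    using mult_carrier_mat[OF Lambda_mat_carrier Cons.IH] by (simp add: Lambda_prod_def)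
qed (simp add: Lambda_prod_def)

lemma Lambda_prod_Nil [simp]: "Lambda_prod m [] = 1\<^sub>m (m + 1)"
  by (simp add: Lambda_prod_def)

lemma Lambda_prod_Cons: "Lambda_prod m (a # as) = Lambda_mat m a * Lambda_prod m as"
  by (simp add: Lambda_prod_def)

lemma Lambda_prod_single: "Lambda_prod m [a] = Lambda_mat m a"
  unfolding Lambda_prod_Cons Lambda_prod_Nil by (rule right_mult_one_mat[OF Lambda_mat_carrier])

lemma col_Lambda_prod_Cons:
  "col (Lambda_prod m (a # as)) 0 = Lambda_mat m a *\<^sub>v col (Lambda_prod m as) 0"
  unfolding Lambda_prod_Cons by (rule col_mult2[OF Lambda_mat_carrier Lambda_prod_carrier]) simp

lemma sum_multichoose:
  assumes "a \<ge> 1"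
  shows "(\<Sum>k\<le>n. multichoose a (int k)) = multichoose (a + 1) (int n)"
proof -
  obtain b where b: "a = Suc b" using assms by (cases a) auto
  show ?thesis
    using sum_choose_lower[of b n]
    by (simp add: b multichoose_def)
qed

lemma col_Lambda_step:
  assumes "a \<ge> 1"
  shows "col (Lambda_prod m [a, 1]) 0 = col (Lambda_prod m [a + 1]) 0"
proof -
  have "(\<Sum>q<m + 1. multichoose a (int m - int p - int q) * multichoose 1 (int m - int q)) =
        multichoose (a + 1) (int m - int p)" if p: "p \<le> m" for p
  proof -
    have "(\<Sum>q<m + 1. multichoose a (int m - int p - int q) * multichoose 1 (int m - int q))
        = (\<Sum>q\<le>m - p. multichoose a (int (m - p - q)))"
      by (rule sum.mono_neutral_cong_right)
         (use p in \<open>auto simp: multichoose_def of_nat_diff intro!: arg_cong2[where f = "(choose)"]\<close>)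
    also have "\<dots> = (\<Sum>k\<le>m - p. multichoose a (int k))"
      by (rule sum.reindex_bij_witness[of _ "\<lambda>k. m - p - k" "\<lambda>k. m - p - k"]) auto
    finally show ?thesis
      using sum_multichoose[OF assms, of "m - p"] p by (simp add: of_nat_diff)
  qed
  note * = this
  show ?thesis
  proof (rule eq_vecI)
    fix p assume "p < dim_vec (col (Lambda_prod m [a + 1]) 0)"
    then have p: "p \<le> m" using Lambda_prod_carrier[of m "[a + 1]"] by auto
    show "col (Lambda_prod m [a, 1]) 0 $ p = col (Lambda_prod m [a + 1]) 0 $ p"
      unfolding col_Lambda_prod_Cons[of m a "[1]"] Lambda_prod_single
      using p arg_cong[OF *[OF p], of real]
      by (simp add: Lambda_mat_def scalar_prod_def atLeast0LessThan del: sum.lessThan_Suc)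
  qed (use Lambda_prod_carrier[of m "[a + 1]"] Lambda_prod_carrier[of m "[a, 1]"] in auto)
qed

lemma col_Lambda_prod_unique:
  assumes "cf_expansion x as" "cf_expansion x bs"
  shows "col (Lambda_prod m as) 0 = col (Lambda_prod m bs) 0"
  using assms
proof (induction as arbitrary: bs x)
  case Nil
  then show ?case by (simp add: cf_expansion_def)
next
  case (Cons a as)
  obtain b bs' where bs: "bs = b # bs'" using Cons.prems(2) by (cases bs) (auto simp: cf_expansion_def)
  have int_case: "as' = [1] \<and> c = a' + 1"
    if "as' \<noteq> []" "\<forall>a\<in>set as'. a \<ge> 1" "cf_value (a' # as') = real c" for a' c :: nat and as'
  proof -
    have ge: "cf_value as' \<ge> 1" using that by (intro cf_value_ge_1)
    have eq: "real a' + 1 / cf_value as' = real c" using that by (simp add: cf_value_Cons)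
    have "0 < 1 / cf_value as'" "1 / cf_value as' \<le> 1" using ge by auto
    then have "c = a' + 1" using eq by linarith
    moreover from this have "cf_value as' = 1" using eq ge by (simp add: field_simps)
    ultimately show ?thesis using cf_value_eq_1 that by blast
  qed
  consider "as = []" "bs' = []" | "as = []" "bs' \<noteq> []" | "as \<noteq> []" "bs' = []"
    | "as \<noteq> []" "bs' \<noteq> []" by blast
  then show ?case
  proof cases
    case 1
    then have "real a = real b" using Cons.prems bs by (simp add: cf_expansion_def)
    then show ?thesis using 1 bs by simp
  next
    case 2
    then have "bs' = [1] \<and> a = b + 1"
      using Cons.prems bs by (intro int_case) (auto simp: cf_expansion_def)
    then show ?thesis using 2 bs col_Lambda_step[of b m] Cons.prems by (auto simp: cf_expansion_def)
  next
    case 3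
    then have "as = [1] \<and> b = a + 1"
      using Cons.prems bs by (intro int_case) (auto simp: cf_expansion_def)
    then show ?thesis using 3 bs col_Lambda_step[of a m] Cons.prems by (auto simp: cf_expansion_def)
  next
    case 4
    have ge: "cf_value as \<ge> 1" "cf_value bs' \<ge> 1"
      using Cons.prems 4 bs by (auto simp: cf_expansion_def intro!: cf_value_ge_1)
    have eq: "real a + 1 / cf_value as = real b + 1 / cf_value bs'"
      using Cons.prems 4 bs by (simp add: cf_expansion_def cf_value_Cons)
    have "0 < 1 / cf_value as" "1 / cf_value as \<le> 1"
         "0 < 1 / cf_value bs'" "1 / cf_value bs' \<le> 1" using ge by auto
    then have "a = b" using eq by linarith
    then have "cf_value as = cf_value bs'" using eq ge by simp
    then have "col (Lambda_prod m as) 0 = col (Lambda_prod m bs') 0"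
      using Cons.prems 4 bs by (intro Cons.IH[of "cf_value as"]) (auto simp: cf_expansion_def)
    then show ?thesis by (simp add: bs col_Lambda_prod_Cons \<open>a = b\<close>)
  qed
qed

theorem r_rat_eq:
  assumes "cf_expansion x as"
  shows "r_rat i m x = r_vec m as $ (m - i)"
proof -
  let ?bs = "SOME as. cf_expansion x as"
  have "cf_expansion x ?bs" using assms by (rule someI)
  then have col: "col (Lambda_prod m ?bs) 0 = col (Lambda_prod m as) 0"
    using assms by (rule col_Lambda_prod_unique)
  have entry: "Lambda_prod m cs $$ (m, 0) = col (Lambda_prod m cs) 0 $ m" for cs
    using Lambda_prod_carrier[of m cs] by auto
  show ?thesis by (simp add: r_rat_def r_vec_def entry col)
qed

end

theory Submission
  imports Defs
begin

text \<open>
Reversing the order of the coordinates turns multiplication by \<open>\<Lambda>\<^sub>m(a)\<close> into the map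
\<open>step m a\<close> on vectors \<open>u 0, \<dots>, u m\<close>, and \<open>r\<^sub>i\<close> of \<open>[a\<^sub>1, \<dots>, a\<^sub>n]\<close> is \<open>u i / u 0\<close>, where \<open>u\<close> is
obtained from the last unit vector by applying the steps for \<open>a\<^sub>n, \<dots>, a\<^sub>1\<close>. So the value depends
on a vector only up to a positive factor, and the theorem is a statement about positive maps acting
on projective space.

Each step maps the nonnegative orthant into the cone \<open>K\<close> of nonnegative nondecreasing vectors
(\<open>nonneg_mono_step\<close>). On \<open>K\<close>, a step is comparable to a map of rank one, with a constant that does
not depend on \<open>a\<close>: the coordinate \<open>j\<close> of \<open>step m a u\<close> lies between \<open>c\<^sub>j * u m\<close> and
\<open>(m + 1) * c\<^sub>j * u m\<close>, where \<open>c\<^sub>j\<close> depends on \<open>a\<close> and \<open>j\<close> only (\<open>step_lower\<close>, \<open>step_upper\<close>). As for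
Birkhoff's theorem on positive maps, it follows that any two consecutive steps are a projective
contraction: the relative error by which two vectors fail to be proportional shrinks by the factor
\<open>m / (m + 1)\<close> (\<open>proj_close_contract\<close>). Hence two rationals whose expansions
share a long prefix have close values of \<open>ln r\<^sub>i\<close>, uniformly (\<open>ln_r_rat_common_prefix\<close>).

For irrational \<open>x\<close>, the rationals near \<open>x\<close> share a long prefix with \<open>x\<close>, and so do the late
convergents. The limit that defines \<open>r\<^sub>i x\<close> therefore exists, and it is also the limit of \<open>r\<^sub>i y\<close> over
all rationals \<open>y\<close> tending to \<open>x\<close>.

For rational \<open>x\<close>, an expansion of a nearby rational \<open>y \<noteq> x\<close> is one of the two expansions of \<open>x\<close>
followed by a large partial quotient \<open>b\<close> and further terms (\<open>large_after_near_rational\<close>); which of the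
two it is depends on the side on which \<open>y\<close> lies. Up to a factor, a step with large \<open>b\<close> sends all
of \<open>K\<close> close to the last unit vector, which is exactly the vector that stands for the end of an
expansion. So again \<open>r\<^sub>i y\<close> tends to \<open>r\<^sub>i x\<close> over the rationals.

A function that is, at every point, the limit of its values on a dense set is continuous
(\<open>continuous_on_dense_limit\<close>).
\<close>

section \<open>The matrix product as an iteration on reversed vectors\<close>

definition mchoose :: "nat \<Rightarrow> nat \<Rightarrow> real" where
  "mchoose a k = real ((a + k - 1) choose k)"

text \<open>
Coordinate \<open>j\<close> stands for row \<open>m - j\<close> of the matrix, so that it carries the index of \<open>r\<^sub>j\<close>, and so that
the images of nonnegative vectors are nondecreasing.
\<close>

definition step :: "nat \<Rightarrow> nat \<Rightarrow> (nat \<Rightarrow> real) \<Rightarrow> nat \<Rightarrow> real" where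
  "step m a u j = (\<Sum>q\<le>j. mchoose a (j - q) * u (m - q))"

definition cf_vec :: "nat \<Rightarrow> nat list \<Rightarrow> nat \<Rightarrow> real" where
  "cf_vec m as = foldr (step m) as (\<lambda>j. of_bool (j = m))"

lemma cf_vec_simps:
  "cf_vec m [] = (\<lambda>j. of_bool (j = m))" "cf_vec m (a # as) = step m a (cf_vec m as)"
  by (simp_all add: cf_vec_def)

lemma Lambda_prod_entry:
  assumes "p \<le> m"
  shows "Lambda_prod m as $$ (p, 0) = cf_vec m as (m - p)"
  using assms
proof (induction as arbitrary: p)
  case Nil
  then show ?case by (auto simp: cf_vec_simps)
next
  case (Cons a as)
  have d: "dim_row (Lambda_prod m as) = m + 1" "dim_col (Lambda_prod m as) = m + 1"
    using Lambda_prod_carrier[of m as] by auto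
  have "Lambda_prod m (a # as) $$ (p, 0)
      = (\<Sum>q<m + 1. real (multichoose a (int m - int p - int q)) * Lambda_prod m as $$ (q, 0))"
    using Cons.prems
    by (simp add: Lambda_prod_Cons Lambda_mat_def scalar_prod_def d atLeast0LessThan
        del: sum.lessThan_Suc)
  also have "\<dots> = (\<Sum>q\<le>m - p. mchoose a (m - p - q) * Lambda_prod m as $$ (q, 0))"
    by (rule sum.mono_neutral_cong_right)
       (use Cons.prems in \<open>auto simp: multichoose_def mchoose_def of_nat_diff nat_diff_distrib'
          intro!: arg_cong2[where f = "(choose)"]\<close>)
  also have "\<dots> = step m a (cf_vec m as) (m - p)"
    unfolding step_def using Cons.prems by (intro sum.cong) (auto simp: Cons.IH)
  finally show ?case by (simp add: cf_vec_simps)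
qed

lemma r_rat_eq_cf_vec:
  assumes "cf_expansion x as" "i \<le> m"
  shows "r_rat i m x = cf_vec m as i / cf_vec m as 0"
proof -
  have d: "dim_row (Lambda_prod m as) = m + 1" "dim_col (Lambda_prod m as) = m + 1"
    using Lambda_prod_carrier[of m as] by auto
  show ?thesis using assms(2)
    by (simp add: r_rat_eq[OF assms(1)] r_vec_def d Lambda_prod_entry)
qed

section \<open>Bounds for one step\<close>

lemma mchoose_0 [simp]: "mchoose a 0 = 1"
  by (simp add: mchoose_def)

lemma mchoose_nonneg [simp]: "0 \<le> mchoose a k"
  by (simp add: mchoose_def)

lemma mchoose_pos: "a \<ge> 1 \<Longrightarrow> 0 < mchoose a k"
  by (simp add: mchoose_def)

lemma mchoose_Suc: "a \<ge> 1 \<Longrightarrow> real (Suc k) * mchoose a (Suc k) = real (a + k) * mchoose a k"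
proof -
  assume "a \<ge> 1"
  then obtain b where "a = Suc b" by (cases a) auto
  moreover have "real (Suc k) * real (Suc (b + k) choose Suc k)
      = real (Suc (b + k)) * real (b + k choose k)"
    unfolding of_nat_mult[symmetric] Suc_times_binomial_eq by (simp only: mult.commute)
  ultimately show ?thesis
    by (simp only: mchoose_def add_Suc add_Suc_right diff_Suc_1)
qed

lemma mchoose_mono:
  assumes "a \<ge> 1" "k \<le> l"
  shows "mchoose a k \<le> mchoose a l"
proof (rule lift_Suc_mono_le[OF _ assms(2)])
  fix k
  have "real (Suc k) * mchoose a k \<le> real (a + k) * mchoose a k"
    using assms(1) by (intro mult_right_mono) auto
  then show "mchoose a k \<le> mchoose a (Suc k)"
    unfolding mchoose_Suc[OF assms(1), symmetric] by simp
qed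

lemma step_0 [simp]: "step m a u 0 = u m"
  by (simp add: step_def)

lemma step_diff: "step m a (\<lambda>j. c * u j - d * v j) j = c * step m a u j - d * step m a v j"
  by (simp add: step_def sum_subtractf sum_distrib_left algebra_simps)

lemma step_mono:
  assumes "\<And>j. j \<le> m \<Longrightarrow> u j \<le> v j"
  shows "step m a u j \<le> step m a v j"
  unfolding step_def by (intro sum_mono mult_left_mono) (auto intro: assms)

definition nonneg_mono :: "nat \<Rightarrow> (nat \<Rightarrow> real) \<Rightarrow> bool" where
  "nonneg_mono m u \<longleftrightarrow> 0 \<le> u 0 \<and> (\<forall>j k. j \<le> k \<and> k \<le> m \<longrightarrow> u j \<le> u k)"

lemma nonneg_monoD: "nonneg_mono m u \<Longrightarrow> j \<le> k \<Longrightarrow> k \<le> m \<Longrightarrow> u j \<le> u k"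
  by (auto simp: nonneg_mono_def)

lemma nonneg_mono_nonneg: "nonneg_mono m u \<Longrightarrow> j \<le> m \<Longrightarrow> 0 \<le> u j"
  unfolding nonneg_mono_def by (meson le0 order_trans)

lemma nonneg_mono_step:
  assumes "a \<ge> 1" and nonneg: "\<And>j. j \<le> m \<Longrightarrow> 0 \<le> u j"
  shows "nonneg_mono m (step m a u)"
proof -
  have "step m a u j \<le> step m a u k" if "j \<le> k" for j k
  proof -
    have "step m a u j \<le> (\<Sum>q\<le>j. mchoose a (k - q) * u (m - q))"
      unfolding step_def using that assms by (intro sum_mono mult_right_mono mchoose_mono) auto
    also have "\<dots> \<le> step m a u k"
      unfolding step_def using that nonneg by (intro sum_mono2) auto
    finally show ?thesis .
  qed
  then show ?thesis using nonneg by (simp add: nonneg_mono_def)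
qed

lemma step_lower:
  assumes "\<And>j. j \<le> m \<Longrightarrow> 0 \<le> u j"
  shows "mchoose a j * u m \<le> step m a u j"
proof -
  have "(\<Sum>q\<in>{0}. mchoose a (j - q) * u (m - q)) \<le> step m a u j"
    unfolding step_def by (intro sum_mono2) (auto intro!: mult_nonneg_nonneg assms)
  then show ?thesis by simp
qed

text \<open>
Together with \<open>step_lower\<close>, this is the uniform comparison with a map of rank one. The constant
\<open>m + 1\<close> counts the summands; each is at most the one for \<open>q = 0\<close>, because both factors are monotone.
\<close>

lemma step_upper:
  assumes "a \<ge> 1" "nonneg_mono m u" "j \<le> m"
  shows "step m a u j \<le> real (m + 1) * (mchoose a j * u m)"
proof -
  have "step m a u j \<le> (\<Sum>q\<le>j. mchoose a j * u m)"
    unfolding step_def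
    by (intro sum_mono mult_mono)
       (use assms in \<open>auto intro: mchoose_mono nonneg_monoD nonneg_mono_nonneg\<close>)
  also have "\<dots> = real (j + 1) * (mchoose a j * u m)" by simp
  also have "\<dots> \<le> real (m + 1) * (mchoose a j * u m)"
    using assms by (intro mult_right_mono) (auto simp: nonneg_mono_nonneg)
  finally show ?thesis .
qed

text \<open>
The vectors that occur are nonzero elements of the cone of nondecreasing vectors; for these the last
coordinate is positive, although the others may vanish (as they do for the last unit vector).
\<close>

definition cone :: "nat \<Rightarrow> (nat \<Rightarrow> real) \<Rightarrow> bool" where
  "cone m u \<longleftrightarrow> nonneg_mono m u \<and> 0 < u m"

lemma cone_step:
  assumes "a \<ge> 1" "cone m u"
  shows "cone m (step m a u)"
proof -
  have nn: "\<And>j. j \<le> m \<Longrightarrow> 0 \<le> u j" using assms(2) by (auto simp: cone_def nonneg_mono_nonneg)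
  have "0 < mchoose a m * u m" using assms by (simp add: mchoose_pos cone_def)
  also have "\<dots> \<le> step m a u m" by (rule step_lower) (rule nn)
  finally show ?thesis using nonneg_mono_step[OF assms(1) nn] by (simp add: cone_def)
qed

lemma cone_foldr_step:
  "\<forall>a\<in>set as. a \<ge> 1 \<Longrightarrow> cone m u \<Longrightarrow> cone m (foldr (step m) as u)"
  by (induction as) (auto intro: cone_step)

lemma cone_unit: "cone m (\<lambda>j. of_bool (j = m))"
  by (auto simp: cone_def nonneg_mono_def)

lemma cone_cf_vec: "\<forall>a\<in>set as. a \<ge> 1 \<Longrightarrow> cone m (cf_vec m as)"
  unfolding cf_vec_def by (intro cone_foldr_step cone_unit)

section \<open>Projective contraction\<close>

text \<open>
The factor \<open>c\<close> makes the relation independent of the scaling of both vectors: \<open>ln (1 + e)\<close> is a bound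
for their Hilbert distance with respect to the orthant.
\<close>

definition proj_close :: "nat \<Rightarrow> real \<Rightarrow> (nat \<Rightarrow> real) \<Rightarrow> (nat \<Rightarrow> real) \<Rightarrow> bool" where
  "proj_close m e u v \<longleftrightarrow> (\<exists>c>0. \<forall>j\<le>m. c * v j \<le> u j \<and> u j \<le> (1 + e) * c * v j)"

lemma step_scale: "step m a (\<lambda>j. c * u j) j = c * step m a u j"
  by (simp add: step_def sum_distrib_left algebra_simps)

text \<open>
Positive linear maps do not increase projective distances.
\<close>

lemma proj_close_step:
  assumes "proj_close m e u v"
  shows "proj_close m e (step m a u) (step m a v)"
proof -
  from assms obtain c where c: "c > 0"
    and "\<And>j. j \<le> m \<Longrightarrow> c * v j \<le> u j" "\<And>j. j \<le> m \<Longrightarrow> u j \<le> (1 + e) * c * v j"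
    by (auto simp: proj_close_def)
  then have "step m a (\<lambda>j. c * v j) j \<le> step m a u j"
    "step m a u j \<le> step m a (\<lambda>j. (1 + e) * c * v j) j" for j
    by (auto intro!: step_mono)
  then show ?thesis using c unfolding proj_close_def step_scale by blast
qed

lemma proj_close_foldr_step: "proj_close m e u v \<Longrightarrow> proj_close m e (foldr (step m) as u) (foldr (step m) as v)"
  by (induction as) (auto intro: proj_close_step)

text \<open>
One step brings any two vectors of the cone within a bounded distance, as both images are within the
factor \<open>m + 1\<close> of multiples of the same vector. This starts the induction for the contraction.
\<close>

lemma proj_close_after_step:
  assumes a: "a \<ge> 1" and u: "cone m u" and v: "cone m v"
  shows "proj_close m (real ((m + 1)\<^sup>2)) (step m a u) (step m a v)"
proof -
  define M where "M = real (m + 1)"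
  have M: "M > 0" by (simp add: M_def)
  have pos: "u m > 0" "v m > 0" using u v by (auto simp: cone_def)
  define c where "c = u m / (M * v m)"
  have c: "c > 0" using pos M by (simp add: c_def)
  have *: "c * step m a v j \<le> step m a u j \<and> step m a u j \<le> (1 + M\<^sup>2) * c * step m a v j"
    if j: "j \<le> m" for j
  proof
    have lo: "mchoose a j * u m \<le> step m a u j" "mchoose a j * v m \<le> step m a v j"
      using u v by (auto simp: cone_def nonneg_mono_nonneg intro!: step_lower)
    have up: "step m a u j \<le> M * (mchoose a j * u m)" "step m a v j \<le> M * (mchoose a j * v m)"
      using u v step_upper[OF a _ j] by (auto simp: cone_def M_def)
    have "c * step m a v j \<le> c * (M * (mchoose a j * v m))"
      using up c by (intro mult_left_mono) auto
    also have "\<dots> = mchoose a j * u m" using pos M by (simp add: c_def)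
    finally show "c * step m a v j \<le> step m a u j" using lo by simp
    have "step m a u j \<le> M\<^sup>2 * c * (mchoose a j * v m)"
      using up pos M by (simp add: c_def power2_eq_square mult.assoc mult.left_commute[of "u m"]
          mult.commute[of "u m"])
    also have "\<dots> \<le> M\<^sup>2 * c * step m a v j" using lo c by (intro mult_left_mono) auto
    also have "\<dots> \<le> (1 + M\<^sup>2) * c * step m a v j"
      using lo c pos mchoose_pos[OF a, of j]
      by (intro mult_right_mono) (auto intro: order_trans[rotated])
    finally show "step m a u j \<le> (1 + M\<^sup>2) * c * step m a v j" .
  qed
  have "M\<^sup>2 = real ((m + 1)\<^sup>2)" by (simp add: M_def)
  then show ?thesis using * c unfolding proj_close_def by metis
qed

text \<open>
Let \<open>c * v \<le> u \<le> d * v\<close>. The inner step turns the differences \<open>u - c * v\<close> and \<open>d * v - u\<close>, of which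
only nonnegativity is known, into elements of the cone. Let \<open>u'\<close> and \<open>v'\<close> be the inner images, with
ratio \<open>s\<close> of last coordinates. By the comparison with a map of rank one, the outer step sends
\<open>u' - c * v'\<close> to at least \<open>(s - c) / (m + 1)\<close> times the image of \<open>v'\<close>, and \<open>d * v' - u'\<close> to at least
\<open>(d - s) / (m + 1)\<close> times it. So both bounds move towards \<open>s\<close> by these amounts, and \<open>d - c\<close> shrinks by the factor
\<open>1 - 1 / (m + 1)\<close>.
\<close>

lemma proj_close_contract:
  assumes a: "a \<ge> 1" and b: "b \<ge> 1" and u: "cone m u" and v: "cone m v"
    and e: "e \<ge> 0" and close: "proj_close m e u v"
  shows "proj_close m (real m / real (m + 1) * e) (step m a (step m b u)) (step m a (step m b v))"
proof -
  define M where "M = real (m + 1)"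
  have M: "M \<ge> 1" by (simp add: M_def)
  define u' v' where "u' = step m b u" and "v' = step m b v"
  have cv: "cone m v'" using cone_step[OF b] v by (simp add: v'_def)
  then have v'm: "v' m > 0" by (simp add: cone_def)
  from close obtain c where c: "c > 0"
    and lo: "\<And>j. j \<le> m \<Longrightarrow> c * v j \<le> u j" and up: "\<And>j. j \<le> m \<Longrightarrow> u j \<le> (1 + e) * c * v j"
    by (auto simp: proj_close_def)
  define d where "d = (1 + e) * c"
  \<comment> \<open>The factor \<open>1\<close> gives the differences the shape of \<open>step_diff\<close>.\<close>
  have "nonneg_mono m (step m b (\<lambda>j. 1 * u j - c * v j))" "nonneg_mono m (step m b (\<lambda>j. d * v j - 1 * u j))"
    using lo up by (auto intro!: nonneg_mono_step b simp: d_def)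
  moreover have "step m b (\<lambda>j. 1 * u j - c * v j) = (\<lambda>j. 1 * u' j - c * v' j)"
    "step m b (\<lambda>j. d * v j - 1 * u j) = (\<lambda>j. d * v' j - 1 * u' j)"
    unfolding step_diff u'_def v'_def by auto
  ultimately have incr: "nonneg_mono m (\<lambda>j. 1 * u' j - c * v' j)" "nonneg_mono m (\<lambda>j. d * v' j - 1 * u' j)"
    by simp_all
  then have nn: "0 \<le> u' m - c * v' m" "0 \<le> d * v' m - u' m"
    using nonneg_mono_nonneg[of m _ m] by fastforce+
  define s where "s = u' m / v' m"
  have s: "u' m = s * v' m" using v'm by (simp add: s_def)
  have cs: "c \<le> s" and sd: "s \<le> d" using nn v'm by (simp_all add: s)
  define c' d' where "c' = c + (s - c) / M" and "d' = d - (d - s) / M"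
  have "c' \<ge> c" using cs M by (simp add: c'_def)
  have *: "c' * step m a v' j \<le> step m a u' j \<and> step m a u' j \<le> d' * step m a v' j"
    if j: "j \<le> m" for j
  proof -
    have "step m a v' j \<le> M * (mchoose a j * v' m)"
      using step_upper[OF a _ j, of v'] cv by (simp add: cone_def M_def)
    then have x: "step m a v' j / M \<le> mchoose a j * v' m" using M by (simp add: field_simps)
    have "mchoose a j * (u' m - c * v' m) \<le> step m a u' j - c * step m a v' j"
      using step_lower[of m "\<lambda>j. 1 * u' j - c * v' j" a j] nonneg_mono_nonneg[OF incr(1)]
      unfolding step_diff by simp
    moreover have "(s - c) * (step m a v' j / M) \<le> (s - c) * (mchoose a j * v' m)"
      using x cs by (intro mult_left_mono) auto
    ultimately have 1: "(s - c) * (step m a v' j / M) \<le> step m a u' j - c * step m a v' j"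
      by (simp add: s algebra_simps)
    have "mchoose a j * (d * v' m - u' m) \<le> d * step m a v' j - step m a u' j"
      using step_lower[of m "\<lambda>j. d * v' j - 1 * u' j" a j] nonneg_mono_nonneg[OF incr(2)]
      unfolding step_diff by simp
    moreover have "(d - s) * (step m a v' j / M) \<le> (d - s) * (mchoose a j * v' m)"
      using x sd by (intro mult_left_mono) auto
    ultimately have 2: "(d - s) * (step m a v' j / M) \<le> d * step m a v' j - step m a u' j"
      by (simp add: s algebra_simps)
    show ?thesis using 1 2 by (simp add: c'_def d'_def algebra_simps)
  qed
  have "d' - c' = (d - c) * (1 - 1 / M)"
    using M by (simp add: c'_def d'_def field_simps)
  also have "\<dots> = real m / M * e * c"
    by (simp add: d_def M_def field_simps)
  also have "\<dots> \<le> real m / M * e * c'"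
    using \<open>c' \<ge> c\<close> e M by (intro mult_left_mono) auto
  finally have d': "d' \<le> (1 + real m / M * e) * c'" by (simp add: algebra_simps)
  have "step m a u' j \<le> (1 + real m / M * e) * c' * step m a v' j" if "j \<le> m" for j
  proof -
    have "0 \<le> step m a v' j"
      using cone_step[OF a cv] that by (auto simp: cone_def nonneg_mono_nonneg)
    then show ?thesis using * [OF that] mult_right_mono[OF d'] by force
  qed
  then show ?thesis
    using * c \<open>c' \<ge> c\<close> unfolding proj_close_def u'_def[symmetric] v'_def[symmetric] M_def[symmetric]
    by (intro exI[of _ c']) auto
qed

text \<open>
The odd length leaves one step for the initial bound and groups the others in pairs.
\<close>

lemma proj_close_common_prefix:
  assumes "length as = 2 * n + 1" "\<forall>a\<in>set as. a \<ge> 1" "cone m u" "cone m v"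
  shows "proj_close m ((real m / real (m + 1)) ^ n * real ((m + 1)\<^sup>2))
           (foldr (step m) as u) (foldr (step m) as v)"
  using assms(1,2)
proof (induction n arbitrary: as)
  case 0
  then obtain a where "as = [a]" by (auto simp: length_Suc_conv)
  then show ?case using proj_close_after_step[of a m u v] 0 assms by simp
next
  case (Suc n)
  then obtain a b cs where as: "as = a # b # cs" "length cs = 2 * n + 1"
    by (auto simp: length_Suc_conv)
  have "cone m (foldr (step m) cs u)" "cone m (foldr (step m) cs v)"
    using Suc.prems as assms by (auto intro!: cone_foldr_step)
  then show ?case
    using proj_close_contract[OF _ _ _ _ _ Suc.IH[of cs], of a b] Suc.prems as
    by (simp add: mult.assoc)
qed

text \<open>
The factor \<open>c\<close> cancels in ratios of coordinates, and the logarithm turns the remaining relative error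
into an absolute one, uniform in the size of the ratios.
\<close>

lemma ln_ratio_diff_le:
  assumes "proj_close m e u v" "e \<ge> 0" "j \<le> m" "u 0 > 0" "v 0 > 0" "u j > 0" "v j > 0"
  shows "\<bar>ln (u j / u 0) - ln (v j / v 0)\<bar> \<le> e"
proof -
  from assms(1) obtain c where c: "c > 0"
    and b: "\<And>j. j \<le> m \<Longrightarrow> c * v j \<le> u j" "\<And>j. j \<le> m \<Longrightarrow> u j \<le> (1 + e) * c * v j"
    by (auto simp: proj_close_def)
  have ln: "ln c + ln (v k) \<le> ln (u k) \<and> ln (u k) \<le> ln (1 + e) + ln c + ln (v k)"
    if "k \<le> m" "u k > 0" "v k > 0" for k
  proof -
    have "ln (c * v k) \<le> ln (u k)" "ln (u k) \<le> ln ((1 + e) * c * v k)"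
      using b[of k] that c assms(2) by auto
    then show ?thesis using that c assms(2) by (simp add: ln_mult)
  qed
  have "ln (1 + e) \<le> e" using assms(2) by (rule ln_add_one_self_le_self)
  then show ?thesis
    using ln[of j] ln[of 0] assms(3-) unfolding abs_le_iff by (simp add: ln_div)
qed

section \<open>The effect of a large partial quotient\<close>

text \<open>
The coordinate \<open>j\<close> of \<open>step m b u\<close> grows like \<open>b ^ j\<close>, so for large \<open>b\<close> the last one dominates.
\<close>

lemma step_large_quotient:
  assumes b: "b \<ge> 1" and u: "cone m u" and j: "j < m"
  shows "step m b u j \<le> real (m * (m + 1)) / real b * step m b u m"
proof -
  obtain k where k: "m = Suc k" using j by (cases m) auto
  have um: "0 < u m" and incr: "nonneg_mono m u" using u by (auto simp: cone_def)
  have "real b * mchoose b k \<le> real (b + k) * mchoose b k" by (intro mult_right_mono) auto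
  also have "\<dots> = real m * mchoose b m" using mchoose_Suc[OF b, of k] by (simp add: k)
  finally have mc: "mchoose b k \<le> real m / real b * mchoose b m" using b by (simp add: field_simps)
  have "step m b u j \<le> step m b u k"
    using cone_step[OF b u] j by (intro nonneg_monoD[of m]) (auto simp: cone_def k)
  also have "\<dots> \<le> real (m + 1) * (mchoose b k * u m)"
    using incr by (intro step_upper b) (auto simp: k)
  also have "\<dots> \<le> real (m + 1) * (real m / real b * mchoose b m * u m)"
    using mc um by (intro mult_left_mono mult_right_mono) auto
  also have "\<dots> = real (m * (m + 1)) / real b * (mchoose b m * u m)" by (simp add: algebra_simps)
  also have "\<dots> \<le> real (m * (m + 1)) / real b * step m b u m"
    by (intro mult_left_mono step_lower nonneg_mono_nonneg[OF incr]) auto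
  finally show ?thesis .
qed

text \<open>
A vector whose last coordinate dominates need not be projectively close to the last unit vector, which
is zero elsewhere; only after one more step are the two close.
\<close>

lemma proj_close_unit:
  assumes a: "a \<ge> 1" and v: "cone m v" and d: "d \<ge> 0" and small: "\<And>j. j < m \<Longrightarrow> v j \<le> d * v m"
  shows "proj_close m (real m * d) (step m a v) (step m a (\<lambda>j. of_bool (j = m)))"
proof -
  have vm: "v m > 0" and nn: "\<And>j. j \<le> m \<Longrightarrow> 0 \<le> v j" using v by (auto simp: cone_def nonneg_mono_nonneg)
  have unit: "step m a (\<lambda>j. of_bool (j = m)) j = mchoose a j" if "j \<le> m" for j
  proof -
    have "step m a (\<lambda>j. of_bool (j = m)) j = (\<Sum>q\<in>{0}. mchoose a (j - q))"
      unfolding step_def by (rule sum.mono_neutral_cong_right) (use that in auto)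
    then show ?thesis by simp
  qed
  have up: "step m a v j \<le> (1 + real m * d) * v m * mchoose a j" if j: "j \<le> m" for j
  proof -
    have "step m a v j = mchoose a j * v m + (\<Sum>q\<in>{1..j}. mchoose a (j - q) * v (m - q))"
      unfolding step_def atMost_atLeast0 by (subst sum.atLeast_Suc_atMost) auto
    also have "(\<Sum>q\<in>{1..j}. mchoose a (j - q) * v (m - q)) \<le> (\<Sum>q\<in>{1..j}. mchoose a j * (d * v m))"
      using j a nn by (intro sum_mono mult_mono mchoose_mono small) auto
    also have "\<dots> = real j * (mchoose a j * (d * v m))" by simp
    also have "\<dots> \<le> real m * (mchoose a j * (d * v m))"
      using j d vm by (intro mult_right_mono) auto
    finally show ?thesis by (simp add: algebra_simps)
  qed
  have lo: "mchoose a j * v m \<le> step m a v j" for j by (rule step_lower) (rule nn)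
  show ?thesis unfolding proj_close_def
    using vm unit up lo by (intro exI[of _ "v m"]) (auto simp: mult.commute)
qed

lemma proj_close_large_quotient:
  assumes "as \<noteq> []" "\<forall>a\<in>set as. a \<ge> 1" "b \<ge> 1" "cone m u"
  shows "proj_close m (real (m * (m * (m + 1))) / real b)
           (foldr (step m) as (step m b u)) (cf_vec m as)"
proof -
  obtain cs a where as: "as = cs @ [a]" using assms(1) by (cases as rule: rev_cases) auto
  have "proj_close m (real m * (real (m * (m + 1)) / real b))
      (step m a (step m b u)) (step m a (\<lambda>j. of_bool (j = m)))"
    using assms as by (intro proj_close_unit cone_step step_large_quotient) auto
  from proj_close_foldr_step[OF this, of cs] show ?thesis by (simp add: as cf_vec_def)
qed

section \<open>Estimates for values at rational numbers\<close>

lemma cf_vec_pos: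
  assumes "as \<noteq> []" "\<forall>a\<in>set as. a \<ge> 1" "j \<le> m"
  shows "cf_vec m as j > 0"
proof -
  obtain a bs where as: "as = a # bs" using assms(1) by (cases as) auto
  have "0 < cf_vec m as 0"
    using cone_cf_vec[of bs m] assms(2) by (simp add: as cf_vec_simps cone_def)
  also have "\<dots> \<le> cf_vec m as j"
    using cone_cf_vec[OF assms(2)] assms(3) by (intro nonneg_monoD[of m]) (auto simp: cone_def)
  finally show ?thesis .
qed

lemma r_rat_pos: "x \<in> \<rat> \<Longrightarrow> x \<ge> 1 \<Longrightarrow> i \<le> m \<Longrightarrow> r_rat i m x > 0"
  using cf_expansion_exists[of x]
  by (auto simp: r_rat_eq_cf_vec cf_vec_pos cf_expansion_def)

lemma ln_r_rat_diff_le: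
  assumes "cf_expansion x as" "cf_expansion y bs" "proj_close m e (cf_vec m as) (cf_vec m bs)"
    "e \<ge> 0" "i \<le> m"
  shows "\<bar>ln (r_rat i m x) - ln (r_rat i m y)\<bar> \<le> e"
  unfolding r_rat_eq_cf_vec[OF assms(1,5)] r_rat_eq_cf_vec[OF assms(2,5)]
  using assms by (intro ln_ratio_diff_le) (auto simp: cf_vec_pos cf_expansion_def)

lemma cf_vec_append: "cf_vec m (as @ bs) = foldr (step m) as (cf_vec m bs)"
  by (simp add: cf_vec_def)

lemma cf_expansion_Cons:
  assumes "a \<ge> 1" "cf_expansion y as"
  shows "cf_expansion (real a + 1 / y) (a # as)"
  using assms by (auto simp: cf_expansion_def cf_value_Cons)

text \<open>
Empty remainders are covered because the last unit vector lies in the cone; so \<open>x\<close> or \<open>y\<close> can be the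
number with expansion \<open>as\<close>, as happens for convergents.
\<close>

lemma ln_r_rat_common_prefix:
  assumes "cf_expansion x (as @ bs)" "cf_expansion y (as @ cs)" "length as = 2 * n + 1" "i \<le> m"
  shows "\<bar>ln (r_rat i m x) - ln (r_rat i m y)\<bar> \<le> (real m / real (m + 1)) ^ n * real ((m + 1)\<^sup>2)"
proof (rule ln_r_rat_diff_le[OF assms(1,2) _ _ assms(4)])
  show "proj_close m ((real m / real (m + 1)) ^ n * real ((m + 1)\<^sup>2))
      (cf_vec m (as @ bs)) (cf_vec m (as @ cs))"
    unfolding cf_vec_append using assms
    by (intro proj_close_common_prefix cone_cf_vec) (auto simp: cf_expansion_def)
qed simp

lemma ln_r_rat_large_quotient:
  assumes "cf_expansion x as" "cf_expansion y (as @ b # bs)" "i \<le> m"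
  shows "\<bar>ln (r_rat i m y) - ln (r_rat i m x)\<bar> \<le> real (m * (m * (m + 1))) / real b"
proof (rule ln_r_rat_diff_le[OF assms(2,1) _ _ assms(3)])
  show "proj_close m (real (m * (m * (m + 1))) / real b) (cf_vec m (as @ b # bs)) (cf_vec m as)"
    unfolding cf_vec_append cf_vec_simps using assms
    by (intro proj_close_large_quotient cone_cf_vec) (auto simp: cf_expansion_def)
qed simp

section \<open>Rationals near an irrational number\<close>

lemma partial_quotient_Suc: "partial_quotient x (Suc n) = partial_quotient (1 / frac x) n"
proof -
  have "complete_quotient x (Suc n) = complete_quotient (1 / frac x) n"
    by (induction n) simp_all
  then show ?thesis by (simp only: partial_quotient_def)
qed

lemma partial_quotients_Suc:
  "map (partial_quotient x) [0..<Suc n] = nat \<lfloor>x\<rfloor> # map (partial_quotient (1 / frac x)) [0..<n]"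
  by (simp add: upt_conv_Cons flip: map_Suc_upt del: upt_Suc)
     (simp add: partial_quotient_Suc partial_quotient_def[of x 0] o_def)

lemma irrational_tail:
  fixes x :: real
  assumes "x \<notin> \<rat>" "x \<ge> 1"
  shows "1 / frac x \<notin> \<rat>" "1 / frac x \<ge> 1" "frac x = x - real (nat \<lfloor>x\<rfloor>)" "frac x > 0" "nat \<lfloor>x\<rfloor> \<ge> 1"
proof -
  show *: "frac x = x - real (nat \<lfloor>x\<rfloor>)" using assms(2) by (simp add: frac_def)
  show pos: "frac x > 0"
    using assms(1) Ints_subset_Rats frac_ge_0[of x] frac_eq_0_iff[of x] by fastforce
  then show "1 / frac x \<ge> 1" using frac_lt_1[of x] by (simp add: field_simps)
  show "1 / frac x \<notin> \<rat>"
  proof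
    assume "1 / frac x \<in> \<rat>"
    then have "inverse (1 / frac x) \<in> \<rat>" by (rule Rats_inverse)
    then have "frac x \<in> \<rat>" by simp
    then have "frac x + real (nat \<lfloor>x\<rfloor>) \<in> \<rat>" by (rule Rats_add) simp
    then show False using assms(1) * by simp
  qed
  show "nat \<lfloor>x\<rfloor> \<ge> 1" using assms(2) by linarith
qed

lemma cf_expansion_convergent:
  assumes "x \<notin> \<rat>" "x \<ge> 1"
  shows "cf_expansion (convergent_cf x n) (map (partial_quotient x) [0..<Suc n])"
proof -
  have "complete_quotient x k \<notin> \<rat> \<and> complete_quotient x k \<ge> 1" for k
  proof (induction k)
    case (Suc k)
    then show ?case using irrational_tail(1,2)[of "complete_quotient x k"] by simp
  qed (use assms in simp)
  then have "partial_quotient x k \<ge> 1" for k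
    unfolding partial_quotient_def by (intro irrational_tail) auto
  then show ?thesis by (auto simp: cf_expansion_def convergent_cf_def simp del: upt_Suc)
qed

text \<open>
Removing the first partial quotient is continuous, so a property of all numbers near the tail of an
expansion passes to the tails of all numbers near \<open>x\<close>. Both inductions along expansions rest on this.
\<close>

lemma eventually_tail:
  fixes x :: real
  assumes "c < x" "eventually P (nhds (1 / (x - c)))"
  shows "eventually (\<lambda>y. P (1 / (y - c))) (nhds x)"
proof -
  have "((\<lambda>y. 1 / (y - c)) \<longlongrightarrow> 1 / (x - c)) (nhds x)"
    using assms(1) by (intro tendsto_intros filterlim_ident) auto
  with assms(2) show ?thesis by (rule eventually_compose_filterlim)
qed

text \<open>
An irrational \<open>x\<close> lies in the interior of the interval of numbers with the same first partial
quotients.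
\<close>

lemma rationals_near_irrational:
  assumes "x \<notin> \<rat>" "x \<ge> 1"
  shows "\<forall>\<^sub>F y in nhds x. y \<in> \<rat> \<longrightarrow> (\<exists>bs. cf_expansion y (map (partial_quotient x) [0..<n] @ bs))"
  using assms
proof (induction n arbitrary: x)
  case 0
  then have "x > 1" by (cases "x = 1") auto
  then have "\<forall>\<^sub>F y in nhds x. y > 1" by (rule order_tendstoD(1)[OF filterlim_ident])
  then show ?case by (rule eventually_mono) (auto intro: cf_expansion_exists)
next
  case (Suc n)
  note tl = irrational_tail[OF Suc.prems]
  define a where "a = nat \<lfloor>x\<rfloor>"
  have a: "a \<ge> 1" "frac x = x - real a" "real a < x" using tl by (auto simp: a_def)
  have "\<forall>\<^sub>F y in nhds x. 1 / (y - real a) \<in> \<rat> \<longrightarrow>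
      (\<exists>bs. cf_expansion (1 / (y - real a)) (map (partial_quotient (1 / frac x)) [0..<n] @ bs))"
    using eventually_tail[OF a(3)] Suc.IH[OF tl(1,2)] unfolding a(2) by blast
  moreover have "\<forall>\<^sub>F y in nhds x. y > real a" using a(3) by (rule order_tendstoD(1)[OF filterlim_ident])
  ultimately show ?case
  proof eventually_elim
    case (elim y)
    show ?case
    proof
      assume "y \<in> \<rat>"
      then have "1 / (y - real a) \<in> \<rat>" by (intro Rats_divide Rats_diff) auto
      then obtain bs where "cf_expansion (1 / (y - real a))
          (map (partial_quotient (1 / frac x)) [0..<n] @ bs)" using elim by auto
      from cf_expansion_Cons[OF a(1) this]
      show "\<exists>bs. cf_expansion y (map (partial_quotient x) [0..<Suc n] @ bs)"
        unfolding partial_quotients_Suc using elim by (auto simp: a_def)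
    qed
  qed
qed

text \<open>
The convergents of \<open>x\<close> and the rationals near \<open>x\<close> enter the same cylinders \<open>cyl N\<close> of numbers with a
common prefix, on which \<open>ln r\<^sub>i\<close> varies by at most \<open>d N\<close>. So the values of \<open>ln r\<^sub>i\<close> at the convergents
form a Cauchy sequence, and its limit is also the limit over all rationals that tend to \<open>x\<close>.
\<close>

lemma r_rat_tendsto_irrational:
  assumes x: "x \<notin> \<rat>" "x \<ge> 1" and i: "i \<le> m"
  shows "(r_rat i m \<longlongrightarrow> r i m x) (inf (nhds x) (principal (\<rat> \<inter> {1..})))"
proof -
  define f where "f y = ln (r_rat i m y)" for y
  define cyl where "cyl N y \<longleftrightarrow> (\<exists>bs. cf_expansion y (map (partial_quotient x) [0..<2 * N + 1] @ bs))"
    for N y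
  define d where "d N = (real m / real (m + 1)) ^ N * real ((m + 1)\<^sup>2)" for N
  have d: "d \<longlonglongrightarrow> 0" unfolding d_def
    by (intro tendsto_mult_left_zero LIMSEQ_power_zero) (simp add: field_simps)
  have close: "\<bar>f y - f z\<bar> \<le> d N" if yz: "cyl N y" "cyl N z" for N y z
  proof -
    obtain bs cs where "cf_expansion y (map (partial_quotient x) [0..<2 * N + 1] @ bs)"
      "cf_expansion z (map (partial_quotient x) [0..<2 * N + 1] @ cs)"
      using yz unfolding cyl_def by blast
    then show ?thesis unfolding f_def d_def by (rule ln_r_rat_common_prefix) (use i in auto)
  qed
  have conv: "cyl N (convergent_cf x n)" if "2 * N \<le> n" for N n
  proof -
    have "[0..<Suc n] = [0..<2 * N + 1] @ [2 * N + 1..<Suc n]"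
      using upt_add_eq_append[of 0 "2 * N + 1" "Suc n - (2 * N + 1)"] that by simp
    then show ?thesis
      using cf_expansion_convergent[OF x, of n] unfolding cyl_def by (metis map_append)
  qed
  have "Cauchy (\<lambda>n. f (convergent_cf x n))"
  proof (rule metric_CauchyI)
    fix e :: real assume "e > 0"
    then obtain N where "d N < e"
      using order_tendstoD(2)[OF d] eventually_happens' sequentially_bot by blast
    then show "\<exists>M. \<forall>n\<ge>M. \<forall>k\<ge>M. dist (f (convergent_cf x n)) (f (convergent_cf x k)) < e"
      using close[OF conv conv] by (intro exI[of _ "2 * N"]) (force simp: dist_real_def)
  qed
  then obtain L where L: "(\<lambda>n. f (convergent_cf x n)) \<longlonglongrightarrow> L"
    using Cauchy_convergent convergent_def by blast
  have exp_f: "exp (f y) = r_rat i m y" if "y \<in> \<rat>" "y \<ge> 1" for y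
    using r_rat_pos[OF that i] by (simp add: f_def)
  have "convergent_cf x n \<in> \<rat> \<and> convergent_cf x n \<ge> 1" for n
  proof -
    have rat: "cf_value as \<in> \<rat>" for as
      by (induction as rule: cf_value.induct) (auto intro!: Rats_add Rats_divide)
    show ?thesis using cf_expansion_convergent[OF x, of n]
      unfolding cf_expansion_def using rat cf_value_ge_1 by metis
  qed
  then have "(\<lambda>n. r_rat i m (convergent_cf x n)) \<longlonglongrightarrow> exp L"
    using tendsto_exp[OF L] by (simp add: exp_f)
  then have r: "r i m x = exp L" using x(1) by (simp add: r_def limI)
  have near: "\<bar>f y - L\<bar> \<le> d N" if "cyl N y" for N y
  proof (rule tendsto_upperbound)
    show "(\<lambda>n. \<bar>f y - f (convergent_cf x n)\<bar>) \<longlonglongrightarrow> \<bar>f y - L\<bar>" by (intro tendsto_intros L)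
    show "\<forall>\<^sub>F n in sequentially. \<bar>f y - f (convergent_cf x n)\<bar> \<le> d N"
      using eventually_ge_at_top[of "2 * N"] by eventually_elim (intro close that conv)
  qed simp
  have "(f \<longlongrightarrow> L) (inf (nhds x) (principal (\<rat> \<inter> {1..})))"
  proof (rule tendstoI)
    fix e :: real assume "e > 0"
    then obtain N where N: "d N < e"
      using order_tendstoD(2)[OF d] eventually_happens' sequentially_bot by blast
    show "\<forall>\<^sub>F y in inf (nhds x) (principal (\<rat> \<inter> {1..})). dist (f y) L < e"
      unfolding eventually_inf_principal
      using rationals_near_irrational[OF x, of "2 * N + 1"]
    proof eventually_elim
      case (elim y)
      have "dist (f y) L < e" if "y \<in> \<rat>"
      proof -
        have "cyl N y" using elim that unfolding cyl_def by blast
        then show ?thesis using near[of N y] N by (simp add: dist_real_def)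
      qed
      then show ?case by simp
    qed
  qed
  from tendsto_exp[OF this] show ?thesis unfolding r
    by (rule Lim_transform_eventually) (auto simp: eventually_inf_principal exp_f)
qed

section \<open>Rationals near a rational number\<close>

lemma cf_expansion_large:
  assumes "z \<in> \<rat>" "z \<ge> real B + 1"
  shows "\<exists>b bs. B \<le> b \<and> cf_expansion z (b # bs)"
proof -
  obtain as where as: "cf_expansion z as" using cf_expansion_exists[of z] assms by auto
  then obtain b bs where bs: "as = b # bs" by (cases as) (auto simp: cf_expansion_def)
  have "z \<le> real b + 1"
  proof (cases "bs = []")
    case True
    then show ?thesis using as bs by (simp add: cf_expansion_def)
  next
    case False
    then have "cf_value bs \<ge> 1" using as bs by (intro cf_value_ge_1) (auto simp: cf_expansion_def)
    then have "1 / cf_value bs \<le> 1" by simp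
    then show ?thesis using as bs False by (auto simp: cf_expansion_def cf_value_Cons)
  qed
  then show ?thesis using as bs assms by (intro exI[of _ b] exI[of _ bs]) auto
qed

text \<open>
Both expansions of \<open>x\<close> are admitted for \<open>as\<close>: they lead to opposite sides of \<open>x\<close>.
\<close>

definition large_after :: "real \<Rightarrow> nat \<Rightarrow> real \<Rightarrow> bool" where
  "large_after x B y \<longleftrightarrow> (\<exists>as b bs. cf_expansion x as \<and> B \<le> b \<and> cf_expansion y (as @ b # bs))"

text \<open>
The numbers just above \<open>a\<close> are \<open>[a, z]\<close> with large \<open>z\<close>, and those just below are \<open>[a - 1, 1, z]\<close>.
\<close>

lemma large_after_near_int:
  assumes a: "a \<ge> 1"
  shows "\<forall>\<^sub>F y in nhds (real a). y \<in> \<rat> \<and> 1 \<le> y \<and> y \<noteq> real a \<longrightarrow> large_after (real a) B y"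
proof -
  have B: "1 / (real B + 2) > 0" by simp
  have "\<forall>\<^sub>F y in nhds (real a). dist y (real a) < 1 / (real B + 2)"
    using B by (rule tendstoD[OF filterlim_ident])
  then show ?thesis
  proof eventually_elim
    case (elim y)
    show ?case
    proof
      assume y: "y \<in> \<rat> \<and> 1 \<le> y \<and> y \<noteq> real a"
      consider "y > real a" | "y < real a" using y by linarith
      then show "large_after (real a) B y"
      proof cases
        case 1
        define z where "z = 1 / (y - real a)"
        have "y - real a < 1 / (real B + 2)" using elim 1 by (simp add: dist_real_def)
        then have "z \<ge> real B + 1" using 1 by (simp add: z_def field_simps)
        moreover have "z \<in> \<rat>" using y by (auto simp: z_def)
        ultimately obtain b bs where b: "B \<le> b" "cf_expansion z (b # bs)"
          using cf_expansion_large by blast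
        have "cf_expansion y ([a] @ b # bs)"
          using cf_expansion_Cons[OF a b(2)] 1 by (simp add: z_def)
        moreover have "cf_expansion (real a) [a]" using a by (simp add: cf_expansion_def)
        ultimately show ?thesis using b(1) unfolding large_after_def by blast
      next
        case 2
        define t where "t = real a - y"
        have t: "0 < t" "t < 1 / (real B + 2)" using elim 2 by (auto simp: dist_real_def t_def)
        then have "1 / t > real B + 2" by (simp add: field_simps)
        \<comment> \<open>The solution of \<open>y = a - 1 + 1 / (1 + 1 / z)\<close>.\<close>
        define z where "z = 1 / t - 1"
        have z: "z \<ge> real B + 1" using \<open>1 / t > real B + 2\<close> by (simp add: z_def)
        have "z \<in> \<rat>" using y by (auto simp: z_def t_def)
        then obtain b bs where b: "B \<le> b" "cf_expansion z (b # bs)"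
          using cf_expansion_large z by blast
        have a2: "a - 1 \<ge> 1" using y 2 by linarith
        have "1 < 1 / t" using \<open>1 / t > real B + 2\<close> by linarith
        then have "t < 1" using t by simp
        then have "1 + 1 / z = 1 / (1 - t)" using t z unfolding z_def by (simp add: field_simps)
        then have "real (a - 1) + 1 / (1 + 1 / z) = y"
          using a by (simp add: t_def of_nat_diff)
        then have "cf_expansion y ([a - 1, 1] @ b # bs)"
          using cf_expansion_Cons[OF a2 cf_expansion_Cons[of 1, OF _ b(2)]] by simp
        moreover have "cf_expansion (real a) [a - 1, 1]"
          using a2 by (simp add: cf_expansion_def of_nat_diff)
        ultimately show ?thesis using b(1) unfolding large_after_def by blast
      qed
    qed
  qed
qed

text \<open>
Induction on the expansion, where the tail at \<open>1\<close> is excluded: there a nearby number can be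
smaller than \<open>1\<close>, and the tail of \<open>y\<close> would not be an admissible one. But then \<open>x\<close> is an integer.
\<close>

lemma large_after_near_rational:
  assumes "cf_expansion x as"
  shows "\<forall>\<^sub>F y in nhds x. y \<in> \<rat> \<and> 1 \<le> y \<and> y \<noteq> x \<longrightarrow> large_after x B y"
  using assms
proof (induction as arbitrary: x)
  case Nil
  then show ?case by (simp add: cf_expansion_def)
next
  case (Cons a as)
  have a: "a \<ge> 1" using Cons.prems by (simp add: cf_expansion_def)
  show ?case
  proof (cases "as = [] \<or> as = [1]")
    case True
    then consider "x = real a" | "x = real (a + 1)" using Cons.prems by (auto simp: cf_expansion_def)
    then show ?thesis using large_after_near_int[of a] large_after_near_int[of "a + 1"] a
      by cases auto
  next
    case False
    define x' where "x' = cf_value as"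
    have as: "cf_expansion x' as" using Cons.prems False by (simp add: cf_expansion_def x'_def)
    then have "x' \<ge> 1" "x' \<noteq> 1"
      using False cf_value_ge_1[of as] cf_value_eq_1[of as] by (auto simp: cf_expansion_def)
    then have x': "x' > 1" by simp
    have x: "x = real a + 1 / x'"
      using Cons.prems False by (auto simp: cf_expansion_def cf_value_Cons x'_def)
    then have ax: "real a < x" and x'_eq: "x' = 1 / (x - real a)" using x' by auto
    have "\<forall>\<^sub>F y in nhds x'. y > 1" using x' by (rule order_tendstoD(1)[OF filterlim_ident])
    then have "\<forall>\<^sub>F y in nhds x'. y \<in> \<rat> \<and> y \<noteq> x' \<longrightarrow> large_after x' B y"
      using Cons.IH[OF as] by eventually_elim auto
    then have "\<forall>\<^sub>F y in nhds x. 1 / (y - real a) \<in> \<rat> \<and> 1 / (y - real a) \<noteq> x' \<longrightarrow>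
        large_after x' B (1 / (y - real a))"
      by (intro eventually_tail[OF ax]) (simp only: x'_eq)
    moreover have "\<forall>\<^sub>F y in nhds x. y > real a" using ax by (rule order_tendstoD(1)[OF filterlim_ident])
    ultimately show ?thesis
    proof eventually_elim
      case (elim y)
      show ?case
      proof
        assume y: "y \<in> \<rat> \<and> 1 \<le> y \<and> y \<noteq> x"
        define y' where "y' = 1 / (y - real a)"
        have y_eq: "y = real a + 1 / y'" using elim by (simp add: y'_def)
        have "y' \<in> \<rat>" using y by (auto simp: y'_def)
        moreover have "y' \<noteq> x'" using y y_eq x by auto
        ultimately have "large_after x' B y'" using elim by (simp add: y'_def)
        then obtain as' b bs where "cf_expansion x' as'" "B \<le> b" "cf_expansion y' (as' @ b # bs)"
          by (auto simp: large_after_def)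
        then have "cf_expansion x (a # as')" "cf_expansion y ((a # as') @ b # bs)"
          using cf_expansion_Cons[OF a] unfolding x y_eq by auto
        then show "large_after x B y" using \<open>B \<le> b\<close> unfolding large_after_def by blast
      qed
    qed
  qed
qed

lemma r_rat_tendsto_rational:
  assumes x: "x \<in> \<rat>" "x \<ge> 1" and i: "i \<le> m"
  shows "(r_rat i m \<longlongrightarrow> r i m x) (inf (nhds x) (principal (\<rat> \<inter> {1..})))"
proof -
  define f where "f y = ln (r_rat i m y)" for y
  have exp_f: "exp (f y) = r_rat i m y" if "y \<in> \<rat>" "y \<ge> 1" for y
    using r_rat_pos[OF that i] by (simp add: f_def)
  have "(f \<longlongrightarrow> f x) (inf (nhds x) (principal (\<rat> \<inter> {1..})))"
  proof (rule tendstoI)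
    fix e :: real assume e: "e > 0"
    define C where "C = real (m * (m * (m + 1)))"
    obtain B where B: "C / e < real B" using reals_Archimedean2 by blast
    have "C / e \<ge> 0" using e by (simp add: C_def)
    then have Bpos: "real B > 0" using B by linarith
    obtain as where "cf_expansion x as" using cf_expansion_exists[OF x] by blast
    from large_after_near_rational[OF this, of B]
    show "\<forall>\<^sub>F y in inf (nhds x) (principal (\<rat> \<inter> {1..})). dist (f y) (f x) < e"
      unfolding eventually_inf_principal
    proof eventually_elim
      case (elim y)
      have "dist (f y) (f x) < e" if y: "y \<in> \<rat> \<inter> {1..}" "y \<noteq> x"
      proof -
        obtain as b bs where "cf_expansion x as" "B \<le> b" "cf_expansion y (as @ b # bs)"
          using elim y by (auto simp: large_after_def)
        then have "dist (f y) (f x) \<le> C / real b"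
          using ln_r_rat_large_quotient i by (simp add: f_def C_def dist_real_def)
        also have "\<dots> \<le> C / real B"
          using \<open>B \<le> b\<close> Bpos by (intro divide_left_mono) (auto simp: C_def)
        also have "\<dots> < e" using B Bpos e by (simp add: field_simps)
        finally show ?thesis .
      qed
      then show ?case using e by (cases "y = x") auto
    qed
  qed
  then have "((\<lambda>y. exp (f y)) \<longlongrightarrow> r i m x) (inf (nhds x) (principal (\<rat> \<inter> {1..})))"
    using tendsto_exp[of f "f x"] x by (simp add: exp_f r_def)
  then show ?thesis
    by (rule Lim_transform_eventually) (auto simp: eventually_inf_principal exp_f)
qed

section \<open>Continuity from limits along a dense set\<close>

text \<open>
Near \<open>x\<close> the values of \<open>f\<close> on \<open>D\<close> are within \<open>e / 2\<close> of \<open>F x\<close>. At any other point \<open>z\<close> of the same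
open neighbourhood, \<open>F z\<close> is a limit of such values, hence satisfies the same bound.
\<close>

lemma continuous_on_dense_limit:
  fixes f F :: "'a::topological_space \<Rightarrow> 'b::metric_space"
  assumes lim: "\<And>x. x \<in> S \<Longrightarrow> (f \<longlongrightarrow> F x) (inf (nhds x) (principal D))"
    and dense: "\<And>x. x \<in> S \<Longrightarrow> inf (nhds x) (principal D) \<noteq> bot"
  shows "continuous_on S F"
  unfolding continuous_on_def
proof (intro ballI tendstoI)
  fix x e assume x: "x \<in> S" and e: "(e::real) > 0"
  have "\<forall>\<^sub>F y in nhds x. y \<in> D \<longrightarrow> dist (f y) (F x) < e / 2"
    using tendstoD[OF lim[OF x], of "e / 2"] e by (simp add: eventually_inf_principal)
  then obtain U where U: "open U" "x \<in> U" and
    close: "\<And>y. y \<in> U \<Longrightarrow> y \<in> D \<Longrightarrow> dist (f y) (F x) < e / 2"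
    by (auto simp: eventually_nhds)
  have "dist (F z) (F x) < e" if z: "z \<in> U" "z \<in> S" for z
  proof -
    have "\<forall>\<^sub>F y in inf (nhds z) (principal D). dist (f y) (F x) \<le> e / 2"
      using eventually_nhds_in_open[OF U(1) z(1)] unfolding eventually_inf_principal
      by eventually_elim (use close in force)
    then have "dist (F z) (F x) \<le> e / 2"
      by (intro tendsto_upperbound[OF tendsto_dist[OF lim[OF z(2)] tendsto_const] _ dense[OF z(2)]])
    then show ?thesis using e by simp
  qed
  then show "\<forall>\<^sub>F z in at x within S. dist (F z) (F x) < e"
    using U by (auto simp: eventually_at_topological)
qed

lemma rationals_ge_1_dense:
  assumes "x \<ge> (1::real)"
  shows "inf (nhds x) (principal (\<rat> \<inter> {1..})) \<noteq> bot"
proof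
  assume "inf (nhds x) (principal (\<rat> \<inter> {1..})) = bot"
  then have "\<forall>\<^sub>F y in nhds x. y \<notin> \<rat> \<inter> {1..}"
    unfolding trivial_limit_def eventually_inf_principal by simp
  then obtain e where e: "e > 0" "\<And>y. dist y x < e \<Longrightarrow> y \<notin> \<rat> \<inter> {1..}"
    by (auto simp: eventually_nhds_metric)
  obtain q where "q \<in> \<rat>" "x < q" "q < x + e" using Rats_dense_in_real[of x "x + e"] e by auto
  then show False using e(2)[of q] assms by (auto simp: dist_real_def)
qed

theorem theorem3:
  fixes i m :: nat
  assumes "m > 1" and "1 \<le> i" and "i \<le> m"
  shows "continuous_on {1..} (\<lambda>x. r i m x)"
proof (rule continuous_on_dense_limit)
  fix x :: real assume "x \<in> {1..}"
  then have x: "x \<ge> 1" by simp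
  show "(r_rat i m \<longlongrightarrow> r i m x) (inf (nhds x) (principal (\<rat> \<inter> {1..})))"
    using r_rat_tendsto_rational[OF _ x assms(3)] r_rat_tendsto_irrational[OF _ x assms(3)]
    by blast
  show "inf (nhds x) (principal (\<rat> \<inter> {1..})) \<noteq> bot" using x by (rule rationals_ge_1_dense)
qed

end
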